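(* Let $n\ge 3$, let $c\ge 1$ and let $F:\mathbb{R}^n\to\mathbb{R}$ be given by $$F(x_1,x_2,\dots,x_n)=\sum_{i=1}^{n-2}x_i^2-x_n^2+c .$$ Let $\Omega\subset\mathbb{R}^n$ be one of the two open sets $\{F<1\}$, $\{F>1\}$, with $\partial\Omega=F^{-1}(1)$. Then there does not exist a minimal hypersurface in $\overline\Omega$ with free boundary on $\partial\Omega$.
   Context: Hypersurfaces $\Sigma$ are compact, connected, smooth, immersed, of dimension $n-1$, contained in $\overline{\Omega}$, with boundary $\partial\Sigma\subset\partial\Omega$. $\Sigma$ has free boundary on $\partial\Omega$ if it meets $\partial\Omega$ orthogonally along $\partial\Sigma$, i.e. the outward unit conormal of $\partial\Sigma$ in $\Sigma$ equals the outward unit normal of $\Omega$ along $\partial\Sigma$. When $c=1$ the set $F^{-1}(1)$ is singular along the line $\{x_i=0 \text{ for all } i\ne n-1\}$ where $\nabla F=0$, and $\partial\Sigma$ is understood to lie in the smooth part $F^{-1}(1)\setminus\{\nabla F=0\}$, so that the orthogonality condition makes sense. *)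

theory Defs
  imports "HOL-Analysis.Analysis"
begin

section \<open>Smooth maps\<close>

primrec Ck_on :: "nat \<Rightarrow> 'b::euclidean_space set \<Rightarrow> ('b \<Rightarrow> 'c::euclidean_space) \<Rightarrow> bool" where
  "Ck_on 0 S f \<longleftrightarrow> continuous_on S f"
| "Ck_on (Suc k) S f \<longleftrightarrow>
     (\<forall>x\<in>S. f differentiable at x) \<and> (\<forall>v. Ck_on k S (\<lambda>x. frechet_derivative f (at x) v))"

text \<open>To be used for open \<open>S\<close> only.\<close>
definition smooth_on :: "'b::euclidean_space set \<Rightarrow> ('b \<Rightarrow> 'c::euclidean_space) \<Rightarrow> bool" where
  "smooth_on S f \<longleftrightarrow> (\<forall>k. Ck_on k S f)"

text \<open>Smoothness on a set that need not be open (below: a relatively open subset of a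
  half-space) means that \<open>f\<close> extends smoothly to a neighbourhood of every point of the set.\<close>
definition smooth_within :: "'b::euclidean_space set \<Rightarrow> ('b \<Rightarrow> 'c::euclidean_space) \<Rightarrow> bool" where
  "smooth_within V f \<longleftrightarrow>
     (\<forall>u\<in>V. \<exists>W g. open W \<and> u \<in> W \<and> smooth_on W g \<and> (\<forall>x\<in>V \<inter> W. g x = f x))"


section \<open>Smooth manifolds with boundary\<close>

definition half_space :: "'m \<Rightarrow> (real^'m::finite) set" where
  "half_space k = {u. 0 \<le> u $ k}"

text \<open>A chart is a pair \<open>(U, \<psi>)\<close> with domain \<open>U\<close>. Values of \<open>\<psi>\<close> off \<open>U\<close> are irrelevant.\<close>
type_synonym ('a, 'm) chart = "'a set \<times> ('a \<Rightarrow> real^'m)"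

definition is_chart :: "'m \<Rightarrow> 'a topology \<Rightarrow> ('a, 'm::finite) chart \<Rightarrow> bool" where
  "is_chart k M = (\<lambda>(U, \<psi>). openin M U \<and> openin (top_of_set (half_space k)) (\<psi> ` U) \<and>
     homeomorphic_map (subtopology M U) (top_of_set (\<psi> ` U)) \<psi>)"

definition smooth_atlas :: "'m \<Rightarrow> 'a topology \<Rightarrow> ('a, 'm::finite) chart set \<Rightarrow> bool" where
  "smooth_atlas k M A \<longleftrightarrow>
     (\<forall>C\<in>A. is_chart k M C) \<and>
     (\<Union>C\<in>A. fst C) = topspace M \<and>
     (\<forall>(U, \<psi>)\<in>A. \<forall>(U', \<psi>')\<in>A. smooth_within (\<psi> ` (U \<inter> U')) (\<psi>' \<circ> inv_into U \<psi>))"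

definition smooth_manifold_with_boundary ::
    "'m \<Rightarrow> 'a topology \<Rightarrow> ('a, 'm::finite) chart set \<Rightarrow> bool" where
  "smooth_manifold_with_boundary k M A \<longleftrightarrow>
     Hausdorff_space M \<and> second_countable M \<and> smooth_atlas k M A"

definition manifold_boundary :: "'m \<Rightarrow> ('a, 'm::finite) chart set \<Rightarrow> 'a set" where
  "manifold_boundary k A = {p. \<exists>(U, \<psi>)\<in>A. p \<in> U \<and> \<psi> p $ k = 0}"


section \<open>Immersed hypersurfaces\<close>

text \<open>The map \<open>\<phi>\<close> read in a chart, a local parametrisation with parameter domain \<open>\<psi> ` U\<close>.\<close>
definition local_param :: "('a, 'm::finite) chart \<Rightarrow> ('a \<Rightarrow> real^'n::finite) \<Rightarrow> real^'m \<Rightarrow> real^'n" where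
  "local_param = (\<lambda>(U, \<psi>) \<phi>. \<phi> \<circ> inv_into U \<psi>)"

definition param_dom :: "('a, 'm::finite) chart \<Rightarrow> (real^'m) set" where
  "param_dom = (\<lambda>(U, \<psi>). \<psi> ` U)"

text \<open>The derivative is taken within the parameter domain \<open>V\<close>, so that it makes sense (and is
  unique) at points of the bounding hyperplane of the half-space as well.\<close>
abbreviation deriv_within ::
    "(real^'m::finite) set \<Rightarrow> (real^'m \<Rightarrow> real^'n::finite) \<Rightarrow> real^'m \<Rightarrow> real^'m \<Rightarrow> real^'n" where
  "deriv_within V X u \<equiv> frechet_derivative X (at u within V)"

definition immersed_hypersurface ::
    "'m \<Rightarrow> 'a topology \<Rightarrow> ('a, 'm::finite) chart set \<Rightarrow> ('a \<Rightarrow> real^'n::finite) \<Rightarrow> bool" where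
  "immersed_hypersurface k M A \<phi> \<longleftrightarrow>
     CARD('n) = CARD('m) + 1 \<and>
     smooth_manifold_with_boundary k M A \<and>
     (\<forall>C\<in>A. smooth_within (param_dom C) (local_param C \<phi>) \<and>
        (\<forall>u\<in>param_dom C. inj (deriv_within (param_dom C) (local_param C \<phi>) u)))"


section \<open>Mean curvature\<close>

definition partial_within ::
    "(real^'m::finite) set \<Rightarrow> (real^'m \<Rightarrow> real^'n::finite) \<Rightarrow> 'm \<Rightarrow> real^'m \<Rightarrow> real^'n" where
  "partial_within V X i u = deriv_within V X u (axis i 1)"

definition first_fundamental_form ::
    "(real^'m::finite) set \<Rightarrow> (real^'m \<Rightarrow> real^'n::finite) \<Rightarrow> real^'m \<Rightarrow> real^'m^'m" where
  "first_fundamental_form V X u =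
     (\<chi> i j. partial_within V X i u \<bullet> partial_within V X j u)"

definition second_fundamental_form ::
    "(real^'m::finite) set \<Rightarrow> (real^'m \<Rightarrow> real^'n::finite) \<Rightarrow> real^'n \<Rightarrow> real^'m \<Rightarrow> real^'m^'m" where
  "second_fundamental_form V X N u =
     (\<chi> i j. partial_within V (partial_within V X j) i u \<bullet> N)"

text \<open>The trace of the shape operator (not divided by the dimension).\<close>
definition mean_curvature ::
    "(real^'m::finite) set \<Rightarrow> (real^'m \<Rightarrow> real^'n::finite) \<Rightarrow> real^'n \<Rightarrow> real^'m \<Rightarrow> real" where
  "mean_curvature V X N u =
     trace (matrix_inv (first_fundamental_form V X u) ** second_fundamental_form V X N u)"

definition unit_normal_at ::
    "(real^'m::finite) set \<Rightarrow> (real^'m \<Rightarrow> real^'n::finite) \<Rightarrow> real^'n \<Rightarrow> real^'m \<Rightarrow> bool" where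
  "unit_normal_at V X N u \<longleftrightarrow> norm N = 1 \<and> (\<forall>w. deriv_within V X u w \<bullet> N = 0)"

text \<open>No orientability is assumed: changing the sign of the normal changes the sign of the mean
  curvature, so its vanishing does not depend on the choice.\<close>
definition minimal :: "('a, 'm::finite) chart set \<Rightarrow> ('a \<Rightarrow> real^'n::finite) \<Rightarrow> bool" where
  "minimal A \<phi> \<longleftrightarrow>
     (\<forall>C\<in>A. \<forall>u\<in>param_dom C. \<forall>N. unit_normal_at (param_dom C) (local_param C \<phi>) N u \<longrightarrow>
        mean_curvature (param_dom C) (local_param C \<phi>) N u = 0)"


section \<open>Free boundary\<close>

text \<open>Outward unit normal of an open set at a boundary point near which the boundary is smooth:
  the normalised gradient of a local defining function that is negative exactly inside.\<close>
definition outward_unit_normal :: "(real^'n::finite) set \<Rightarrow> real^'n \<Rightarrow> real^'n \<Rightarrow> bool" where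
  "outward_unit_normal \<Omega> p \<nu> \<longleftrightarrow>
     (\<exists>W \<rho> D. open W \<and> p \<in> W \<and> smooth_on W \<rho> \<and> \<Omega> \<inter> W = {x\<in>W. \<rho> x < 0} \<and> \<rho> p = 0 \<and>
        GDERIV \<rho> p :> D \<and> D \<noteq> 0 \<and> \<nu> = D /\<^sub>R norm D)"

text \<open>At a boundary point \<open>u $ k = 0\<close>: a unit tangent vector of the hypersurface, orthogonal to
  the image of \<open>{v. v $ k = 0}\<close> (the tangent space of the boundary), which points out of the
  hypersurface because \<open>w\<close> points out of the half-space.\<close>
definition outward_unit_conormal ::
    "'m \<Rightarrow> (real^'m::finite) set \<Rightarrow> (real^'m \<Rightarrow> real^'n::finite) \<Rightarrow> real^'m \<Rightarrow> real^'n \<Rightarrow> bool" where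
  "outward_unit_conormal k V X u \<eta> \<longleftrightarrow>
     norm \<eta> = 1 \<and>
     (\<exists>w. w $ k < 0 \<and> \<eta> = deriv_within V X u w) \<and>
     (\<forall>v. v $ k = 0 \<longrightarrow> \<eta> \<bullet> deriv_within V X u v = 0)"

definition has_free_boundary ::
    "(real^'n::finite) set \<Rightarrow> 'm \<Rightarrow> ('a, 'm::finite) chart set \<Rightarrow> ('a \<Rightarrow> real^'n) \<Rightarrow> bool" where
  "has_free_boundary \<Omega> k A \<phi> \<longleftrightarrow>
     (\<forall>C\<in>A. \<forall>u\<in>param_dom C. u $ k = 0 \<longrightarrow>
        (\<exists>\<eta>. outward_unit_conormal k (param_dom C) (local_param C \<phi>) u \<eta> \<and>
             outward_unit_normal \<Omega> (local_param C \<phi> u) \<eta>))"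


section \<open>The domains\<close>

lemma frontier_quadric_domain:
  fixes e :: "nat \<Rightarrow> 'n::finite" and F :: "real^'n \<Rightarrow> real"
  assumes n: "n \<ge> 3" and e: "bij_betw e {1..n} UNIV"
    and F: "F = (\<lambda>x. (\<Sum>i=1..n-2. (x $ e i)^2) - (x $ e n)^2 + c)"
    and \<Omega>: "\<Omega> = {x. F x < 1} \<or> \<Omega> = {x. F x > 1}"
  shows "frontier \<Omega> = {x. F x = 1}"
proof -
  have cont: "continuous_on UNIV F" unfolding F by (intro continuous_intros)
  have op: "open {x. F x < 1}" "open {x. F x > 1}"
    using cont by (auto intro!: open_Collect_less continuous_intros)
  have cl: "closed {x. F x \<le> 1}" "closed {x. F x \<ge> 1}"
    using cont by (auto intro!: closed_Collect_le continuous_intros)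
  have inj: "e i = e j \<longleftrightarrow> i = j" if "i \<in> {1..n}" "j \<in> {1..n}" for i j
    using e that by (meson bij_betw_def inj_on_eq_iff)
  define s where "s = (\<lambda>x::real. if x \<ge> 0 then 1 else -1 :: real)"
  have s: "(x + s x * t)^2 > x^2" if "t > 0" for x t :: real
  proof -
    have "(x + s x * t)^2 = x^2 + 2 * \<bar>x\<bar> * t + t^2"
      by (auto simp: s_def power2_eq_square algebra_simps)
    moreover have "2 * \<bar>x\<bar> * t \<ge> 0" "t^2 > 0" using that by auto
    ultimately show ?thesis by linarith
  qed
  have down: "F (p + t *\<^sub>R axis (e n) (s (p $ e n))) < F p" if "t > 0" for p t
  proof -
    have "(\<Sum>i=1..n-2. ((p + t *\<^sub>R axis (e n) (s (p $ e n))) $ e i)^2) = (\<Sum>i=1..n-2. (p $ e i)^2)"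
      using n by (intro sum.cong refl) (auto simp: axis_def inj)
    then show ?thesis using s[OF that, of "p $ e n"] unfolding F by (simp add: axis_def mult.commute)
  qed
  have up: "F (p + t *\<^sub>R axis (e 1) (s (p $ e 1))) > F p" if "t > 0" for p t
  proof -
    have "(\<Sum>i=1..n-2. ((p + t *\<^sub>R axis (e 1) (s (p $ e 1))) $ e i)^2) > (\<Sum>i=1..n-2. (p $ e i)^2)"
    proof (rule sum_strict_mono_ex1)
      show "\<forall>i\<in>{1..n-2}. (p $ e i)\<^sup>2 \<le> ((p + t *\<^sub>R axis (e 1) (s (p $ e 1))) $ e i)\<^sup>2"
        using n s[OF that, of "p $ e 1"] by (auto simp: axis_def inj mult.commute)
      show "\<exists>i\<in>{1..n-2}. (p $ e i)\<^sup>2 < ((p + t *\<^sub>R axis (e 1) (s (p $ e 1))) $ e i)\<^sup>2"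
        using n s[OF that, of "p $ e 1"] by (intro bexI[of _ 1]) (auto simp: axis_def mult.commute)
    qed auto
    moreover have "e n \<noteq> e 1" using n by (simp add: inj)
    ultimately show ?thesis unfolding F by (simp add: axis_def)
  qed
  have lim: "p \<in> closure S" if "\<And>t. t > 0 \<Longrightarrow> p + t *\<^sub>R d \<in> S" for p d :: "real^'n" and S
  proof -
    have "(\<lambda>k. p + inverse (real (Suc k)) *\<^sub>R d) \<longlonglongrightarrow> p + 0 *\<^sub>R d"
      by (intro tendsto_intros LIMSEQ_inverse_real_of_nat)
    moreover have "p + inverse (real (Suc k)) *\<^sub>R d \<in> S" for k by (intro that) simp
    ultimately show ?thesis
      unfolding closure_sequential
      by (intro exI[of _ "\<lambda>k. p + inverse (real (Suc k)) *\<^sub>R d"] conjI allI) (simp_all only: scale_zero_left add_0_right)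
  qed
  have "closure {x. F x < 1} = {x. F x \<le> 1}"
  proof
    show "closure {x. F x < 1} \<subseteq> {x. F x \<le> 1}" using cl by (intro closure_minimal) auto
    show "{x. F x \<le> 1} \<subseteq> closure {x. F x < 1}"
    proof
      fix p assume "p \<in> {x. F x \<le> 1}"
      then have "p + t *\<^sub>R axis (e n) (s (p $ e n)) \<in> {x. F x < 1}" if "t > 0" for t
        using down[OF that, of p] by simp
      then show "p \<in> closure {x. F x < 1}" by (rule lim)
    qed
  qed
  moreover have "closure {x. F x > 1} = {x. F x \<ge> 1}"
  proof
    show "closure {x. F x > 1} \<subseteq> {x. F x \<ge> 1}" using cl by (intro closure_minimal) auto
    show "{x. F x \<ge> 1} \<subseteq> closure {x. F x > 1}"
    proof
      fix p assume "p \<in> {x. F x \<ge> 1}"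
      then have "p + t *\<^sub>R axis (e 1) (s (p $ e 1)) \<in> {x. F x > 1}" if "t > 0" for t
        using up[OF that, of p] by simp
      then show "p \<in> closure {x. F x > 1}" by (rule lim)
    qed
  qed
  ultimately show ?thesis using \<Omega> op by (auto simp: frontier_def interior_open)
qed

end

theory Submission
  imports Defs
begin

text \<open>
  Let \<open>J = {n - 1, n}\<close> for \<open>\<Omega> = {F < 1}\<close> and \<open>J = {1, \<dots>, n - 1}\<close> for \<open>\<Omega> = {F > 1}\<close>, and
  consider a maximum point of \<open>f = \<Sum>i\<in>J. x\<^sub>i\<^sup>2\<close> on the hypersurface. The outward unit normal of
  \<open>\<Omega>\<close> is a positive multiple of \<open>\<nabla>F\<close> or \<open>-\<nabla>F\<close>, and in both cases the derivative of \<open>f\<close> in its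
  direction is nonpositive. Together with the free boundary condition this makes the maximum point
  critical for \<open>f\<close> even if it lies on the boundary, and then the Hessian of \<open>f\<close> is nonpositive there
  in all directions. But on a minimal hypersurface coordinates are harmonic, so that the trace of the
  Hessian is \<open>2 * (\<Sum>i\<in>J. |\<nabla>x\<^sub>i|\<^sup>2)\<close>; it is positive because the tangent space has codimension one
  and \<open>J\<close> has at least two elements.
\<close>

section \<open>Derivatives within half-spaces\<close>

text \<open>An interior point admits every direction, a point of the bounding hyperplane those that
  do not leave the half-space. Only \<open>t \<ge> 0\<close> is covered, so everything built on this
  is one-sided.\<close>

lemma half_space_direction_eventually:
  fixes u q :: "real^'m::finite"
  assumes V: "openin (top_of_set (half_space k)) V" and u: "u \<in> V"
    and q: "0 < u $ k \<or> 0 \<le> q $ k"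
  obtains d where "d > 0" "\<And>t. \<lbrakk>0 \<le> t; t < d\<rbrakk> \<Longrightarrow> u + t *\<^sub>R q \<in> V"
proof -
  obtain T where T: "open T" "V = half_space k \<inter> T" using V by (auto simp: openin_open)
  \<comment> \<open>At an interior point the open half-space is built into \<open>S\<close>, so that
    openness alone keeps the segment in \<open>V\<close>; at a boundary point
    \<open>0 \<le> q $ k\<close> does this.\<close>
  define S where "S = (if 0 < u $ k then {x. 0 < x $ k} \<inter> T else T)"
  have "open S" unfolding S_def using T(1)
    by (auto intro!: open_Int open_Collect_less continuous_intros)
  moreover have "u \<in> S" using u T by (auto simp: S_def)
  ultimately have "\<forall>\<^sub>F t in at (0::real). u + t *\<^sub>R q \<in> S"
    by (intro topological_tendstoD[where l = u]) (auto intro!: tendsto_eq_intros)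
  then obtain d where d: "d > 0" "\<And>t. \<lbrakk>t \<noteq> 0; dist t 0 < d\<rbrakk> \<Longrightarrow> u + t *\<^sub>R q \<in> S"
    by (auto simp: eventually_at)
  have "u + t *\<^sub>R q \<in> V" if t: "0 \<le> t" "t < d" for t
  proof (cases "t = 0")
    case False
    then have "u + t *\<^sub>R q \<in> S" using d t by auto
    moreover have "0 \<le> u $ k" using u T by (auto simp: half_space_def)
    ultimately show ?thesis using q t
      by (auto simp: T(2) S_def half_space_def split: if_splits)
  qed (use u in simp)
  with d(1) show ?thesis using that by blast
qed

text \<open>Basis vectors never point out of the half-space, so \<open>V\<close> contains short
  segments from \<open>u\<close> in all coordinate directions. This determines a derivative within
  \<open>V\<close>, and the choice made by \<open>frechet_derivative\<close> is harmless.\<close>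

lemma deriv_within_eq:
  fixes X :: "real^'m::finite \<Rightarrow> real^'n::finite"
  assumes V: "openin (top_of_set (half_space k)) V" and u: "u \<in> V"
    and X: "(X has_derivative D) (at u within V)"
  shows "deriv_within V X u = D"
proof -
  have "\<exists>d. 0 < \<bar>d\<bar> \<and> \<bar>d\<bar> < r \<and> u + d *\<^sub>R i \<in> V" if i: "i \<in> Basis" and r: "r > 0" for i and r :: real
  proof -
    have "0 \<le> i $ k" using i by (auto simp: Basis_vec_def axis_def)
    then obtain d where d: "d > 0" "\<And>t. \<lbrakk>0 \<le> t; t < d\<rbrakk> \<Longrightarrow> u + t *\<^sub>R i \<in> V"
      using half_space_direction_eventually[OF V u] by metis
    then show ?thesis using r by (intro exI[of _ "min d r / 2"]) auto
  qed
  moreover have "(X has_derivative deriv_within V X u) (at u within V)"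
    using X by (meson differentiable_def frechet_derivative_works)
  ultimately show ?thesis using X frechet_derivative_unique_within by metis
qed

lemma has_derivative_within_eq_on_open:
  assumes "(g has_derivative D) (at x)" "open W" "x \<in> V" "x \<in> W"
    "\<And>y. y \<in> V \<inter> W \<Longrightarrow> g y = f y"
  shows "(f has_derivative D) (at x within V)"
proof -
  obtain r where "r > 0" "ball x r \<subseteq> W" using assms(2,4) open_contains_ball by blast
  then show ?thesis using assms(3,5)
    by (intro has_derivative_transform_within[OF has_derivative_at_withinI[OF assms(1)]])
      (auto simp: dist_commute subset_iff)
qed

lemma smooth_within_has_derivative:
  fixes X :: "real^'m::finite \<Rightarrow> real^'n::finite"
  assumes "smooth_within V X" "u \<in> V"
  shows "(X has_derivative deriv_within V X u) (at u within V)"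
proof -
  obtain W g where W: "open W" "u \<in> W" "smooth_on W g" and eq: "\<And>x. x \<in> V \<inter> W \<Longrightarrow> g x = X x"
    using bspec[OF assms(1)[unfolded smooth_within_def] assms(2)] by metis
  have "Ck_on (Suc 0) W g" using W(3) unfolding smooth_on_def by blast
  then have "(g has_derivative frechet_derivative g (at u)) (at u)"
    using W(2) frechet_derivative_works by auto
  then have "(X has_derivative frechet_derivative g (at u)) (at u within V)"
    using W(1) assms(2) W(2) eq by (rule has_derivative_within_eq_on_open)
  then show ?thesis using differentiable_def frechet_derivative_works by blast
qed

text \<open>Replaces \<open>X\<close> near \<open>u\<close> by a smooth extension \<open>g\<close>
  with ordinary derivatives. The first partials agree on all of \<open>V \<inter> W\<close>, not
  only at \<open>u\<close>, and therefore the second ones agree as well.\<close>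

lemma smooth_within_local:
  fixes X :: "real^'m::finite \<Rightarrow> real^'n::finite"
  assumes V: "openin (top_of_set (half_space k)) V" and u: "u \<in> V" and X: "smooth_within V X"
  obtains W g where "open W" "u \<in> W" "\<And>x. x \<in> V \<inter> W \<Longrightarrow> g x = X x"
    "\<And>x. x \<in> W \<Longrightarrow> (g has_derivative frechet_derivative g (at x)) (at x)"
    "\<And>x v. x \<in> W \<Longrightarrow> (\<lambda>y. frechet_derivative g (at y) v) differentiable at x"
    "\<And>x. x \<in> V \<inter> W \<Longrightarrow> deriv_within V X x = frechet_derivative g (at x)"
    "\<And>x j. x \<in> V \<inter> W \<Longrightarrow> deriv_within V (partial_within V X j) x
        = frechet_derivative (\<lambda>y. frechet_derivative g (at y) (axis j 1)) (at x)"
proof -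
  obtain W g where W: "open W" "u \<in> W" "smooth_on W g" and eq: "\<And>x. x \<in> V \<inter> W \<Longrightarrow> g x = X x"
    using bspec[OF X[unfolded smooth_within_def] u] by metis
  have ck: "Ck_on (Suc (Suc 0)) W g" using W(3) unfolding smooth_on_def by blast
  have d1: "(g has_derivative frechet_derivative g (at x)) (at x)" if "x \<in> W" for x
    using ck that frechet_derivative_works by auto
  have d2: "(\<lambda>y. frechet_derivative g (at y) v) differentiable at x" if "x \<in> W" for x v
    using ck that by auto
  have e1: "deriv_within V X x = frechet_derivative g (at x)" if x: "x \<in> V \<inter> W" for x
    using x eq by (intro deriv_within_eq[OF V]
        has_derivative_within_eq_on_open[OF d1 W(1)]) auto
  have e2: "deriv_within V (partial_within V X j) x
      = frechet_derivative (\<lambda>y. frechet_derivative g (at y) (axis j 1)) (at x)" if x: "x \<in> V \<inter> W" for x j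
  proof (rule deriv_within_eq[OF V])
    have "((\<lambda>y. frechet_derivative g (at y) (axis j 1)) has_derivative
        frechet_derivative (\<lambda>y. frechet_derivative g (at y) (axis j 1)) (at x)) (at x)"
      using d2 x frechet_derivative_works by blast
    then show "(partial_within V X j has_derivative
        frechet_derivative (\<lambda>y. frechet_derivative g (at y) (axis j 1)) (at x)) (at x within V)"
      by (rule has_derivative_within_eq_on_open[OF _ W(1)]) (use x e1 in \<open>auto simp: partial_within_def\<close>)
  qed (use x in blast)
  show ?thesis using that[OF W(1,2) eq d1 d2 e1 e2] .
qed

text \<open>If \<open>f' 0 > 0\<close>, then \<open>f\<close> exceeds \<open>f 0\<close> just to the
  right of 0. If \<open>f' 0 = 0\<close> and \<open>f'' > 0\<close>, then \<open>f'\<close> is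
  positive there, so that \<open>f\<close> increases strictly. Both contradict a maximum over
  \<open>t \<ge> 0\<close>.\<close>

lemma one_sided_max_derivatives:
  fixes f f' :: "real \<Rightarrow> real"
  assumes d: "d > 0" and f: "\<And>t. \<bar>t\<bar> < d \<Longrightarrow> DERIV f t :> f' t"
    and f': "DERIV f' 0 :> f''" and max: "\<And>t. \<lbrakk>0 \<le> t; t < d\<rbrakk> \<Longrightarrow> f t \<le> f 0"
  shows "f' 0 \<le> 0" "f' 0 = 0 \<Longrightarrow> f'' \<le> 0"
proof -
  show "f' 0 \<le> 0"
  proof (rule ccontr)
    assume "\<not> f' 0 \<le> 0"
    then obtain r where r: "r > 0" "\<And>h. \<lbrakk>h > 0; h < r\<rbrakk> \<Longrightarrow> f 0 < f (0 + h)"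
      using DERIV_pos_inc_right[OF f[of 0]] d by auto
    have "0 < min d r / 2" "min d r / 2 < d" "min d r / 2 < r" using d r(1) by auto
    then show False using r(2)[of "min d r / 2"] max[of "min d r / 2"] by auto
  qed
  show "f'' \<le> 0" if z: "f' 0 = 0"
  proof (rule ccontr)
    assume "\<not> f'' \<le> 0"
    then obtain r where r: "r > 0" "\<And>h. \<lbrakk>h > 0; h < r\<rbrakk> \<Longrightarrow> f' 0 < f' (0 + h)"
      using DERIV_pos_inc_right[OF f'] by auto
    define s where "s = min d r / 2"
    have s: "0 < s" "s < d" "s < r" using d r(1) by (auto simp: s_def)
    have "f 0 < f s"
    proof (rule DERIV_pos_imp_increasing_open[OF s(1)])
      fix x assume x: "0 < x" "x < s"
      have "f' x > 0" using r(2)[of x] x s z by simp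
      then show "\<exists>y. DERIV f x :> y \<and> y > 0" using f[of x] x s by auto
    next
      show "continuous_on {0..s} f"
      proof (rule DERIV_continuous_on)
        fix x assume "x \<in> {0..s}"
        then have "DERIV f x :> f' x" using f[of x] s by simp
        then show "(f has_real_derivative f' x) (at x within {0..s})"
          by (rule has_field_derivative_at_within)
      qed
    qed
    then show False using max[of s] s by auto
  qed
qed

section \<open>Traces with respect to the first fundamental form\<close>

text \<open>Turns a trace with respect to the first fundamental form into a sum over an orthonormal
  frame: \<open>q\<close> consists of the preimages under \<open>L\<close> of an orthonormal basis
  of \<open>range L\<close>. With the \<open>q a\<close> as columns of \<open>Q\<close> and
  \<open>G\<close> the Gram matrix, \<open>transpose Q ** G ** Q = mat 1\<close>, hence the inverse
  of \<open>G\<close> is \<open>Q ** transpose Q\<close>.\<close>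

lemma trace_inverse_Gram:
  fixes L :: "real^'m::finite \<Rightarrow> real^'n::finite"
  assumes L: "linear L" "inj L"
  obtains q :: "'m \<Rightarrow> real^'m"
  where "\<And>S. trace (matrix_inv (\<chi> i j. L (axis i 1) \<bullet> L (axis j 1)) ** S) = (\<Sum>a\<in>UNIV. q a \<bullet> (S *v q a))"
    "span (range q) = UNIV"
proof -
  \<comment> \<open>Equal dimensions give an isometry \<open>f\<close> onto \<open>range L\<close>;
    it carries the standard basis to an orthonormal one.\<close>
  have "dim (range L) = dim (UNIV :: (real^'m) set)"
    using dim_image_eq[OF L(1)] L(2) by (simp add: inj_on_subset)
  then obtain f where f: "linear f" "f ` (UNIV :: (real^'m) set) = range L" "\<And>x. norm (f x) = norm x"
    using isometry_subspaces[of "UNIV :: (real^'m) set" "range L"] L(1)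
    by (metis UNIV_I linear_subspace_image subspace_UNIV)
  have "\<forall>a. \<exists>q. L q = f (axis a 1)" using f(2) by (metis UNIV_I image_iff)
  then obtain q where q: "\<And>a. L (q a) = f (axis a 1)" by metis
  have iso: "f x \<bullet> f y = x \<bullet> y" for x y
    using f(1,3) by (simp add: dot_norm linear_add[symmetric])
  define Q :: "real^'m^'m" where "Q = (\<chi> i a. q a $ i)"
  define G where "G = (\<chi> i j. L (axis i 1) \<bullet> L (axis j 1))"
  have bil: "x \<bullet> (G *v y) = L x \<bullet> L y" for x y
  proof -
    have exp: "L v = (\<Sum>i\<in>UNIV. v $ i *\<^sub>R L (axis i 1))" for v
      using arg_cong[OF basis_expansion[of v], of L]
      by (simp add: linear_sum[OF L(1)] linear_cmul[OF L(1)] scalar_mult_eq_scaleR)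
    show ?thesis unfolding exp[of x] exp[of y]
      by (simp add: inner_vec_def[of x] matrix_vector_mult_def G_def inner_sum_left
          inner_sum_right[where f = "\<lambda>j. y $ j *\<^sub>R L (axis j 1)"] sum_distrib_left mult_ac)
        (rule sum.swap)
  qed
  have col: "(A ** B) $ i $ j = row i A \<bullet> column j B" for A B :: "real^'m^'m" and i j
    by (simp add: matrix_matrix_mult_def row_def column_def inner_vec_def)
  have QGQ: "transpose Q ** (G ** Q) = mat 1"
  proof -
    have "(transpose Q ** (G ** Q)) $ a $ b = mat 1 $ a $ b" for a b
    proof -
      have "column b (G ** Q) = G *v q b"
        by (simp add: column_def matrix_matrix_mult_def matrix_vector_mult_def Q_def vec_eq_iff)
      moreover have "row a (transpose Q) = q a" by (simp add: row_def transpose_def Q_def vec_eq_iff)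
      ultimately show ?thesis
        by (simp add: col bil q iso mat_def inner_axis_axis)
    qed
    then show ?thesis by (simp add: vec_eq_iff)
  qed
  then have inv1: "(G ** Q) ** transpose Q = mat 1" by (simp add: matrix_left_right_inverse)
  then have inv: "G ** (Q ** transpose Q) = mat 1" by (simp add: matrix_mul_assoc)
  then have inv': "(Q ** transpose Q) ** G = mat 1" by (simp add: matrix_left_right_inverse)
  \<comment> \<open>\<open>matrix_inv\<close> is a choice among two-sided inverses, so an inverse
    has to be exhibited before anything is known about it.\<close>
  have "G ** matrix_inv G = mat 1"
    unfolding matrix_inv_def by (rule someI2[of _ "Q ** transpose Q"]) (use inv inv' in auto)
  then have Ginv: "matrix_inv G = Q ** transpose Q"
    by (metis inv' matrix_mul_assoc matrix_mul_lid matrix_mul_rid)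
  show ?thesis
  proof
    fix S :: "real^'m^'m"
    have "trace (matrix_inv G ** S) = trace (transpose Q ** (S ** Q))"
      by (metis Ginv matrix_mul_assoc trace_mul_sym)
    also have "\<dots> = (\<Sum>a\<in>UNIV. q a \<bullet> (S *v q a))"
    proof -
      have "(transpose Q ** (S ** Q)) $ a $ a = q a \<bullet> (S *v q a)" for a
      proof -
        have "column a (S ** Q) = S *v q a"
          by (simp add: column_def matrix_matrix_mult_def matrix_vector_mult_def Q_def vec_eq_iff)
        moreover have "row a (transpose Q) = q a" by (simp add: row_def transpose_def Q_def vec_eq_iff)
        ultimately show ?thesis by (simp add: col)
      qed
      then show ?thesis by (simp add: trace_def)
    qed
    finally show "trace (matrix_inv (\<chi> i j. L (axis i 1) \<bullet> L (axis j 1)) ** S) = (\<Sum>a\<in>UNIV. q a \<bullet> (S *v q a))"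
      by (simp add: G_def)
  next
    have "w \<in> span (range q)" for w
    proof -
      have "L w \<in> f ` UNIV" using f(2) by auto
      then obtain y where y: "L w = f y" by auto
      have "L w = L (\<Sum>a\<in>UNIV. y $ a *\<^sub>R q a)"
        using arg_cong[OF basis_expansion[of y], of f]
        by (simp add: y linear_sum[OF L(1)] linear_cmul[OF L(1)] linear_sum[OF f(1)]
            linear_cmul[OF f(1)] scalar_mult_eq_scaleR q)
      then have "w = (\<Sum>a\<in>UNIV. y $ a *\<^sub>R q a)" using L(2) by (simp add: inj_eq)
      then show ?thesis by (auto intro!: span_sum span_scale intro: span_base)
    qed
    then show "span (range q) = UNIV" by blast
  qed
qed

section \<open>Maximum points of a partial distance function\<close>

text \<open>The second assumption on \<open>P\<close> makes it an orthogonal projection. Let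
  \<open>p = P (X u)\<close>. Half the second derivative of the squared norm of
  \<open>P \<circ> X\<close> along \<open>q\<close> is
  \<open>P (L q) \<bullet> P (L q) + p \<bullet> D2 q\<close>, where \<open>L\<close> is the
  derivative of \<open>X\<close> at \<open>u\<close>. At the maximum it is nonpositive and
  \<open>p\<close> is normal to the hypersurface; by minimality the terms with \<open>D2\<close>
  cancel when summed over an orthonormal frame, which forces all \<open>P (L q)\<close> to
  vanish.\<close>

lemma minimal_max_point_projection_deriv_0:
  fixes X :: "real^'m::finite \<Rightarrow> real^'n::finite" and P :: "real^'n \<Rightarrow> real^'n"
  assumes V: "openin (top_of_set (half_space k)) V" and u: "u \<in> V"
    and X: "smooth_within V X" and inj: "inj (deriv_within V X u)"
    and minimal: "\<And>N. unit_normal_at V X N u \<Longrightarrow> mean_curvature V X N u = 0"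
    and P: "linear P" "\<And>x y. P x \<bullet> P y = P x \<bullet> y"
    and max: "\<And>x. x \<in> V \<Longrightarrow> norm (P (X x)) \<le> norm (P (X u))"
    and bdry: "u $ k = 0 \<Longrightarrow> \<exists>w. w $ k < 0 \<and> P (X u) \<bullet> deriv_within V X u w \<le> 0"
  shows "P (deriv_within V X u w) = 0"
proof -
  obtain W g where W: "open W" "u \<in> W" and gX: "\<And>x. x \<in> V \<inter> W \<Longrightarrow> g x = X x"
    and d1: "\<And>x. x \<in> W \<Longrightarrow> (g has_derivative frechet_derivative g (at x)) (at x)"
    and d2: "\<And>x v. x \<in> W \<Longrightarrow> (\<lambda>y. frechet_derivative g (at y) v) differentiable at x"
    and e1: "\<And>x. x \<in> V \<inter> W \<Longrightarrow> deriv_within V X x = frechet_derivative g (at x)"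
    and e2: "\<And>x j. x \<in> V \<inter> W \<Longrightarrow> deriv_within V (partial_within V X j) x
        = frechet_derivative (\<lambda>y. frechet_derivative g (at y) (axis j 1)) (at x)"
    using smooth_within_local[OF V u X] by blast
  have uW: "u \<in> V \<inter> W" using u W by blast
  define L where "L = frechet_derivative g (at u)"
  have Leq: "deriv_within V X u = L" using e1[OF uW] by (simp add: L_def)
  have L: "linear L" "inj L" using d1[OF W(2)] inj Leq by (auto simp: L_def dest: has_derivative_linear)
  define H where "H j = frechet_derivative (\<lambda>y. frechet_derivative g (at y) (axis j 1)) (at u)" for j
  have H: "((\<lambda>y. frechet_derivative g (at y) (axis j 1)) has_derivative H j) (at u)" for j
    unfolding H_def using d2[OF W(2)] frechet_derivative_works by blast
  have Hlin: "linear (H j)" for j using H has_derivative_linear by blast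
  define p where "p = P (X u)"
  have gu: "g u = X u" using gX uW by blast
  have Pbl: "bounded_linear P" using P(1) linear_conv_bounded_linear by blast
  have expand: "T q = (\<Sum>i\<in>UNIV. q $ i *\<^sub>R T (axis i 1))" if "linear T" for T :: "real^'m \<Rightarrow> real^'n" and q
    using arg_cong[OF basis_expansion[of q], of T]
    by (simp add: linear_sum[OF that] linear_cmul[OF that] scalar_mult_eq_scaleR)
  \<comment> \<open>\<open>D2 q\<close> is the second derivative of \<open>g\<close> at
    \<open>u\<close> along \<open>q\<close>, written with the derivatives \<open>H j\<close> of the
    partials, as in \<open>second_fundamental_form\<close>.\<close>
  define D2 where "D2 q = (\<Sum>j\<in>UNIV. q $ j *\<^sub>R H j q)" for q
  \<comment> \<open>The second derivative test is one-sided, since \<open>u\<close> may lie on the bounding hyperplane.\<close>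
  have test: "p \<bullet> L q \<le> 0" "p \<bullet> L q = 0 \<Longrightarrow> P (L q) \<bullet> P (L q) + p \<bullet> D2 q \<le> 0"
    if q: "0 < u $ k \<or> 0 \<le> q $ k" for q
  proof -
    obtain d where d: "d > 0" "\<And>t. \<lbrakk>0 \<le> t; t < d\<rbrakk> \<Longrightarrow> u + t *\<^sub>R q \<in> V"
      using half_space_direction_eventually[OF V u q] by blast
    have "\<forall>\<^sub>F t in at (0::real). u + t *\<^sub>R q \<in> W"
      using W by (intro topological_tendstoD[where l = u]) (auto intro!: tendsto_eq_intros)
    then obtain d' where d': "d' > 0" "\<And>t. \<lbrakk>t \<noteq> 0; dist t 0 < d'\<rbrakk> \<Longrightarrow> u + t *\<^sub>R q \<in> W"
      by (auto simp: eventually_at)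
    have inW: "u + t *\<^sub>R q \<in> W" if "\<bar>t\<bar> < d'" for t
      using d'(2)[of t] that W by (cases "t = 0") auto
    define \<gamma> where "\<gamma> t = u + t *\<^sub>R q" for t :: real
    have \<gamma>: "(\<gamma> has_derivative (\<lambda>h. h *\<^sub>R q)) (at t)" for t
      unfolding \<gamma>_def by (auto intro!: derivative_eq_intros)
    define f where "f t = P (g (\<gamma> t)) \<bullet> P (g (\<gamma> t))" for t
    \<comment> \<open>The derivative along \<open>q\<close> is expanded in partials, whose
      derivatives at \<open>u\<close> are the \<open>H j\<close>. The second \<open>P\<close> is
      dropped by \<open>P(2)\<close>.\<close>
    define f' where "f' t = 2 * (P (g (\<gamma> t)) \<bullet> (\<Sum>j\<in>UNIV. q $ j *\<^sub>R frechet_derivative g (at (\<gamma> t)) (axis j 1)))" for t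
    have dg: "((\<lambda>t. P (g (\<gamma> t))) has_derivative (\<lambda>h. h *\<^sub>R P (frechet_derivative g (at (\<gamma> t)) q))) (at t)"
      if "\<bar>t\<bar> < d'" for t
    proof -
      have "\<gamma> t \<in> W" using inW[OF that] by (simp add: \<gamma>_def)
      then have *: "((\<lambda>t. g (\<gamma> t)) has_derivative (\<lambda>h. frechet_derivative g (at (\<gamma> t)) (h *\<^sub>R q))) (at t)"
        using has_derivative_compose[OF \<gamma> d1] by simp
      have "linear (frechet_derivative g (at (\<gamma> t)))"
        using d1[OF \<open>\<gamma> t \<in> W\<close>] has_derivative_linear by blast
      then show ?thesis using bounded_linear.has_derivative[OF Pbl *]
        by (simp add: linear_cmul linear_cmul[OF P(1)])
    qed
    have f: "DERIV f t :> f' t" if "\<bar>t\<bar> < d'" for t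
    proof -
      have "linear (frechet_derivative g (at (\<gamma> t)))"
        using d1[OF inW[OF that]] has_derivative_linear by (auto simp: \<gamma>_def)
      note ex = expand[OF this, of q]
      have "(f has_derivative (\<lambda>h. h * f' t)) (at t)"
        unfolding f_def f'_def ex[symmetric]
        by (rule has_derivative_eq_rhs[OF has_derivative_inner[OF dg[OF that] dg[OF that]]])
          (auto simp: fun_eq_iff P(2) inner_commute algebra_simps)
      then show ?thesis by (simp add: has_field_derivative_def mult_commute_abs)
    qed
    have f': "DERIV f' 0 :> 2 * (P (L q) \<bullet> L q + p \<bullet> D2 q)"
    proof -
      have g0: "\<gamma> 0 = u" by (simp add: \<gamma>_def)
      have H': "((\<lambda>t. frechet_derivative g (at (\<gamma> t)) (axis j 1)) has_derivative (\<lambda>h. H j (h *\<^sub>R q))) (at 0)" for j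
        using has_derivative_compose[OF \<gamma>[of 0], of _ "H j"] H[of j] by (simp add: g0)
      have "((\<lambda>t. \<Sum>j\<in>UNIV. q $ j *\<^sub>R frechet_derivative g (at (\<gamma> t)) (axis j 1))
           has_derivative (\<lambda>h. \<Sum>j\<in>UNIV. q $ j *\<^sub>R H j (h *\<^sub>R q))) (at 0)"
        by (intro has_derivative_sum has_derivative_scaleR_right H')
      moreover have "(\<lambda>h. \<Sum>j\<in>UNIV. q $ j *\<^sub>R H j (h *\<^sub>R q)) = (\<lambda>h. h *\<^sub>R D2 q)"
        by (auto simp: fun_eq_iff D2_def linear_cmul[OF Hlin] scaleR_sum_right mult_ac)
      ultimately have s: "((\<lambda>t. \<Sum>j\<in>UNIV. q $ j *\<^sub>R frechet_derivative g (at (\<gamma> t)) (axis j 1))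
           has_derivative (\<lambda>h. h *\<^sub>R D2 q)) (at 0)" by simp
      have dg0: "((\<lambda>t. P (g (\<gamma> t))) has_derivative (\<lambda>h. h *\<^sub>R P (L q))) (at 0)"
        using dg[of 0] d' by (simp add: g0 L_def)
      have "(f' has_derivative (\<lambda>h. h * (2 * (P (L q) \<bullet> L q + p \<bullet> D2 q)))) (at 0)"
        unfolding f'_def
        by (rule has_derivative_eq_rhs[OF has_derivative_mult_right[OF has_derivative_inner[OF dg0 s]]])
          (simp add: fun_eq_iff g0 gu L_def[symmetric] expand[OF L(1), symmetric] p_def algebra_simps)
      then show ?thesis by (simp add: has_field_derivative_def mult_commute_abs)
    qed
    have mx: "f t \<le> f 0" if "0 \<le> t" "t < min d d'" for t
    proof -
      have "u + t *\<^sub>R q \<in> V \<inter> W" using d(2) inW that by auto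
      then have "norm (P (g (\<gamma> t))) \<le> norm (P (g (\<gamma> 0)))" using max gX gu by (simp add: \<gamma>_def)
      then show ?thesis by (simp add: f_def power2_norm_eq_inner[symmetric])
    qed
    have md: "min d d' > 0" using d d' by simp
    have f'0: "f' 0 = 2 * (p \<bullet> L q)"
      by (simp add: f'_def \<gamma>_def gu p_def L_def[symmetric] expand[OF L(1), symmetric])
    show "p \<bullet> L q \<le> 0"
      using one_sided_max_derivatives(1)[OF md f f' mx] f'0 by simp
    show "P (L q) \<bullet> P (L q) + p \<bullet> D2 q \<le> 0" if "p \<bullet> L q = 0"
      using one_sided_max_derivatives(2)[OF md f f' mx] f'0 that P(2) by simp
  qed
  have neg: "T (- q) = - T q" if "linear T" for T :: "real^'m \<Rightarrow> real^'n" and q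
    using that by (rule linear_neg)
  \<comment> \<open>In the interior \<open>q\<close> and \<open>-q\<close> are both admissible. On
    the boundary this holds for directions with \<open>k\<close>-th component 0, while
    \<open>-w\<close> points inward and gives the inequality opposite to \<open>bdry\<close>. Every
    \<open>q\<close> is a combination of \<open>w\<close> and such a direction.\<close>
  have crit: "p \<bullet> L q = 0" for q
  proof (cases "0 < u $ k")
    case True
    then show ?thesis using test(1)[of q] test(1)[of "-q"] by (simp add: neg[OF L(1)])
  next
    case False
    have "0 \<le> u $ k" using u V by (auto simp: half_space_def dest: openin_imp_subset)
    with False obtain w where w: "w $ k < 0" "p \<bullet> L w \<le> 0"
      using bdry by (auto simp: p_def Leq)
    define v where "v = q - (q $ k / w $ k) *\<^sub>R w"
    have "v $ k = 0" using w by (simp add: v_def)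
    then have "p \<bullet> L v = 0" using test(1)[of v] test(1)[of "-v"] by (simp add: neg[OF L(1)])
    moreover have "p \<bullet> L w = 0" using test(1)[of "-w"] w by (simp add: neg[OF L(1)])
    moreover have "L q = L v + (q $ k / w $ k) *\<^sub>R L w"
      by (simp add: v_def linear_diff[OF L(1)] linear_cmul[OF L(1)])
    ultimately show ?thesis by (simp add: inner_add_right)
  qed
  have D2neg: "D2 (- q) = D2 q" for q by (simp add: D2_def neg[OF Hlin])
  \<comment> \<open>\<open>D2\<close> and the squared norm are even in \<open>q\<close>, so a
    direction pointing out of the half-space may be replaced by its negative.\<close>
  have hess: "P (L q) \<bullet> P (L q) + p \<bullet> D2 q \<le> 0" for q
  proof (cases "0 \<le> q $ k")
    case False
    then show ?thesis using test(2)[OF _ crit, of "-q"]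
      by (simp add: D2neg neg[OF L(1)] linear_neg[OF P(1)])
  qed (use test(2)[OF _ crit] in blast)
  have gram: "first_fundamental_form V X u = (\<chi> i j. L (axis i 1) \<bullet> L (axis j 1))"
    by (simp add: first_fundamental_form_def partial_within_def Leq)
  obtain q :: "'m \<Rightarrow> real^'m"
    where tr: "\<And>S. trace (matrix_inv (\<chi> i j. L (axis i 1) \<bullet> L (axis j 1)) ** S) = (\<Sum>a\<in>UNIV. q a \<bullet> (S *v q a))"
      and span: "span (range q) = UNIV"
    by (rule trace_inverse_Gram[OF L]) (rule that)
  \<comment> \<open>By \<open>crit\<close>, normalising a nonzero \<open>p\<close> gives a unit
    normal \<open>N\<close>; the sum is then \<open>norm p\<close> times the mean curvature with
    respect to \<open>N\<close>.\<close>
  have sum0: "(\<Sum>a\<in>UNIV. p \<bullet> D2 (q a)) = 0"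
  proof (cases "p = 0")
    case False
    define N where "N = p /\<^sub>R norm p"
    have "unit_normal_at V X N u"
      using False crit by (simp add: unit_normal_at_def N_def Leq inner_commute)
    then have "(\<Sum>a\<in>UNIV. q a \<bullet> (second_fundamental_form V X N u *v q a)) = 0"
      using minimal unfolding mean_curvature_def gram tr by blast
    moreover have "q a \<bullet> (second_fundamental_form V X N u *v q a) = N \<bullet> D2 (q a)" for a
    proof -
      have "partial_within V (partial_within V X j) i u = H j (axis i 1)" for i j
        using e2[OF uW] by (simp add: partial_within_def[of V "partial_within V X j"] H_def)
      then have "q a \<bullet> (second_fundamental_form V X N u *v q a)
          = (\<Sum>i\<in>UNIV. \<Sum>j\<in>UNIV. q a $ i * (q a $ j * (N \<bullet> H j (axis i 1))))"
        by (simp add: second_fundamental_form_def inner_vec_def[of "q a"] matrix_vector_mult_def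
            sum_distrib_left mult_ac inner_commute[of N])
      also have "\<dots> = (\<Sum>j\<in>UNIV. \<Sum>i\<in>UNIV. q a $ i * (q a $ j * (N \<bullet> H j (axis i 1))))"
        by (rule sum.swap)
      also have "\<dots> = N \<bullet> D2 (q a)"
        unfolding D2_def inner_sum_right inner_scaleR_right
        by (subst expand[OF Hlin]) (simp add: inner_sum_right sum_distrib_left mult_ac)
      finally show ?thesis .
    qed
    ultimately have "(\<Sum>a\<in>UNIV. N \<bullet> D2 (q a)) = 0" by simp
    moreover have "p \<bullet> y = norm p * (N \<bullet> y)" for y using False by (simp add: N_def)
    ultimately show ?thesis by (simp add: sum_distrib_left[symmetric])
  qed simp
  have "P (L (q a)) = 0" for a
  proof -
    have "(\<Sum>a\<in>UNIV. P (L (q a)) \<bullet> P (L (q a)) + p \<bullet> D2 (q a)) \<le> 0"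
      by (intro sum_nonpos hess)
    then have "(\<Sum>a\<in>UNIV. P (L (q a)) \<bullet> P (L (q a))) = 0"
      by (intro antisym sum_nonneg) (auto simp: sum.distrib sum0)
    then have "P (L (q a)) \<bullet> P (L (q a)) = 0" by (simp add: sum_nonneg_eq_0_iff)
    then show ?thesis by simp
  qed
  then have "(P \<circ> L) x = 0" if "x \<in> range q" for x using that by auto
  moreover have "w \<in> span (range q)" unfolding span by (rule UNIV_I)
  ultimately have "(P \<circ> L) w = 0"
    by (rule linear_eq_0_on_span[OF linear_compose[OF L(1) P(1)]])
  then show ?thesis by (simp add: Leq)
qed

section \<open>From charts to the maximum argument on the whole hypersurface\<close>

lemma immersed_hypersurface_chart:
  fixes \<phi> :: "'a \<Rightarrow> real^'n::finite"
  assumes imm: "immersed_hypersurface k M A \<phi>" and C: "(U, \<psi>) \<in> A"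
  shows "openin M U" "openin (top_of_set (half_space k)) (param_dom (U, \<psi>))"
    "continuous_map (subtopology M U) (top_of_set (param_dom (U, \<psi>))) \<psi>"
    "x \<in> U \<Longrightarrow> local_param (U, \<psi>) \<phi> (\<psi> x) = \<phi> x"
proof -
  have chart: "is_chart k M (U, \<psi>)"
    using imm C by (auto simp: immersed_hypersurface_def smooth_manifold_with_boundary_def smooth_atlas_def)
  show op: "openin M U" and "openin (top_of_set (half_space k)) (param_dom (U, \<psi>))"
    using chart by (auto simp: is_chart_def param_dom_def)
  have hom: "homeomorphic_map (subtopology M U) (top_of_set (param_dom (U, \<psi>))) \<psi>"
    using chart by (auto simp: is_chart_def param_dom_def)
  then show "continuous_map (subtopology M U) (top_of_set (param_dom (U, \<psi>))) \<psi>"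
    by (rule homeomorphic_imp_continuous_map)
  have "inj_on \<psi> U"
    using homeomorphic_imp_injective_map[OF hom] openin_subset[OF op] by (simp add: Int_absorb1)
  then show "local_param (U, \<psi>) \<phi> (\<psi> x) = \<phi> x" if "x \<in> U"
    using that by (simp add: local_param_def)
qed

text \<open>Continuity is not built into \<open>immersed_hypersurface\<close>; it is glued from the
  charts, where \<phi> is a smooth local parametrisation after a homeomorphism. It provides the
  maximum on a compact \<open>M\<close>.\<close>

lemma immersed_hypersurface_continuous_map:
  fixes \<phi> :: "'a \<Rightarrow> real^'n::finite"
  assumes imm: "immersed_hypersurface k M A \<phi>"
  shows "continuous_map M euclidean \<phi>"
proof (rule pasting_lemma)
  show "openin M (fst C)" if "C \<in> A" for C
    using immersed_hypersurface_chart(1)[OF imm, of "fst C" "snd C"] that by simp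
next
  fix C assume "C \<in> A"
  then obtain U \<psi> where C: "(U, \<psi>) \<in> A" "C = (U, \<psi>)" by (cases C) auto
  note ch = immersed_hypersurface_chart[OF imm C(1)]
  define V X where "V = param_dom (U, \<psi>)" and "X = local_param (U, \<psi>) \<phi>"
  have sm: "smooth_within V X" using imm C by (auto simp: immersed_hypersurface_def V_def X_def)
  have "continuous (at u within V) X" if u: "u \<in> V" for u
    using smooth_within_has_derivative[OF sm u] by (rule has_derivative_continuous)
  then have "continuous_on V X" by (simp add: continuous_on_eq_continuous_within)
  then have "continuous_map (subtopology M U) euclidean (X \<circ> \<psi>)"
    by (intro continuous_map_compose[OF ch(3)[folded V_def]]) simp
  then have "continuous_map (subtopology M U) euclidean \<phi>"
    by (rule continuous_map_eq) (simp add: ch(4) X_def)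
  then show "continuous_map (subtopology M (fst C)) euclidean \<phi>" by (simp add: C(2))
next
  fix x assume "x \<in> topspace M"
  moreover have "(\<Union>C\<in>A. fst C) = topspace M"
    using imm by (simp add: immersed_hypersurface_def smooth_manifold_with_boundary_def smooth_atlas_def)
  ultimately show "\<exists>C. C \<in> A \<and> x \<in> fst C \<and> \<phi> x = \<phi> x" by blast
qed simp

text \<open>Otherwise a space of codimension one would lie in a coordinate subspace of codimension
  \<open>card J\<close>, which is at least 2.\<close>

lemma linear_range_two_coordinates_nonzero:
  fixes L :: "real^'m::finite \<Rightarrow> real^'n::finite"
  assumes L: "linear L" "inj L" and card: "CARD('n) = CARD('m) + 1" and J: "2 \<le> card J"
  shows "\<exists>w. \<exists>i\<in>J. L w $ i \<noteq> 0"
proof (rule ccontr)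
  assume "\<not> ?thesis"
  then have "range L \<subseteq> {x. \<forall>b\<in>Basis. b \<notin> (\<lambda>i. axis i 1) ` (- J) \<longrightarrow> x \<bullet> b = 0}"
    by (auto simp: Basis_vec_def inner_axis)
  then have "dim (range L) \<le> dim {x::real^'n. \<forall>b\<in>Basis. b \<notin> (\<lambda>i. axis i 1) ` (- J) \<longrightarrow> x \<bullet> b = 0}"
    by (rule dim_subset)
  also have "\<dots> = card ((\<lambda>i. axis i (1::real)) ` (- J) :: (real^'n) set)"
    by (rule dim_substandard) (auto simp: Basis_vec_def)
  also have "\<dots> \<le> card (- J)" by (simp add: card_image_le)
  also have "\<dots> = CARD('n) - card J" by (simp add: Compl_eq_Diff_UNIV card_Diff_subset)
  also have "dim (range L) = CARD('m)"
    using dim_image_eq[OF L(1), of UNIV] L(2) by (simp add: inj_on_subset)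
  \<comment> \<open>Positivity of \<open>CARD('m)\<close> covers the case in which the subtraction
    of natural numbers is truncated to 0.\<close>
  finally show False using card J zero_less_card_finite[where 'a = 'm] by linarith
qed

text \<open>The last assumption says that the sum of the squares of the coordinates in
  \<open>J\<close> does not increase in the direction of the outward normal. At a maximum point of
  this sum the projection to these coordinates kills the whole tangent space, which is impossible in
  codimension one.\<close>

lemma minimal_free_boundary_False:
  fixes \<phi> :: "'a \<Rightarrow> real^'n::finite" and k :: "'m::finite"
  assumes imm: "immersed_hypersurface k M A \<phi>" and M: "topspace M \<noteq> {}" "compact_space M"
    and minimal: "minimal A \<phi>" and free: "has_free_boundary \<Omega> k A \<phi>"
    and J: "2 \<le> card J"
    and bdry: "\<And>x \<nu>. \<lbrakk>x \<in> manifold_boundary k A; outward_unit_normal \<Omega> (\<phi> x) \<nu>\<rbrakk>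
        \<Longrightarrow> (\<Sum>i\<in>J. \<phi> x $ i * \<nu> $ i) \<le> 0"
  shows False
proof -
  define P :: "real^'n \<Rightarrow> real^'n" where "P x = (\<chi> i. if i \<in> J then x $ i else 0)" for x
  have P: "linear P" by (rule linearI) (auto simp: P_def vec_eq_iff)
  have PP: "P x \<bullet> P y = P x \<bullet> y" for x y
    by (auto simp: P_def inner_vec_def intro!: sum.cong)
  have Pin: "P x \<bullet> y = (\<Sum>i\<in>J. x $ i * y $ i)" for x y
    by (simp add: P_def inner_vec_def if_distrib[of "\<lambda>z. z * _"] sum.If_cases)
  define f where "f x = norm (P (\<phi> x))" for x
  have "continuous_map euclidean euclidean (\<lambda>x. norm (P x))"
    using P by (simp add: continuous_on_norm linear_continuous_on linear_conv_bounded_linear)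
  then have cont: "continuous_map M euclideanreal f"
    using continuous_map_compose[OF immersed_hypersurface_continuous_map[OF imm]]
    unfolding f_def[abs_def] o_def by blast
  have "compact (f ` topspace M)"
    using image_compactin[OF _ cont] M(2) by (simp add: compact_space_def)
  then obtain x where x: "x \<in> topspace M" "\<And>y. y \<in> topspace M \<Longrightarrow> f y \<le> f x"
    using compact_attains_sup[of "f ` topspace M"] M(1) by auto
  have "(\<Union>C\<in>A. fst C) = topspace M"
    using imm by (simp add: immersed_hypersurface_def smooth_manifold_with_boundary_def smooth_atlas_def)
  then have "x \<in> (\<Union>C\<in>A. fst C)" using x(1) by simp
  then obtain U \<psi> where C: "(U, \<psi>) \<in> A" and xU: "x \<in> U" by (auto simp: fst_def)
  note ch = immersed_hypersurface_chart[OF imm C]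
  define V X u where "V = param_dom (U, \<psi>)" and "X = local_param (U, \<psi>) \<phi>" and "u = \<psi> x"
  have V: "openin (top_of_set (half_space k)) V" using ch(2) by (simp add: V_def)
  have V_eq: "V = \<psi> ` U" by (simp add: V_def param_dom_def)
  have u: "u \<in> V" using xU by (simp add: V_eq u_def)
  have Xu: "X u = \<phi> x" using ch(4) xU by (simp add: X_def u_def)
  have sm: "smooth_within V X" and inj: "inj (deriv_within V X u)" and card: "CARD('n) = CARD('m) + 1"
    using imm C u by (auto simp: immersed_hypersurface_def V_def X_def)
  have der0: "P (deriv_within V X u w) = 0" for w
  proof (rule minimal_max_point_projection_deriv_0[OF V u sm inj _ P PP])
    show "mean_curvature V X N u = 0" if "unit_normal_at V X N u" for N
      using minimal C u that by (auto simp: minimal_def V_def X_def)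
    show "norm (P (X v)) \<le> norm (P (X u))" if v: "v \<in> V" for v
    proof -
      obtain y where y: "y \<in> U" "v = \<psi> y" using v V_eq by auto
      then have "f y \<le> f x" using x(2) openin_subset[OF ch(1)] by auto
      then show ?thesis using y ch(4) Xu by (simp add: f_def X_def)
    qed
    assume u0: "u $ k = 0"
    then obtain \<eta> where \<eta>: "outward_unit_conormal k V X u \<eta>" "outward_unit_normal \<Omega> (X u) \<eta>"
      using free C u by (auto simp: has_free_boundary_def V_def X_def)
    \<comment> \<open>The free boundary condition makes \<eta> both the normal, for which the sign
      is known, and the image of a vector \<open>w\<close> pointing out of the half-space.\<close>
    have "x \<in> manifold_boundary k A"
      using C xU u0 by (auto simp: manifold_boundary_def u_def)
    then have "P (X u) \<bullet> \<eta> \<le> 0" using bdry \<eta>(2) by (simp add: Xu Pin)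
    then show "\<exists>w. w $ k < 0 \<and> P (X u) \<bullet> deriv_within V X u w \<le> 0"
      using \<eta>(1) by (auto simp: outward_unit_conormal_def)
  qed
  have "linear (deriv_within V X u)"
    using smooth_within_has_derivative[OF sm u] by (rule has_derivative_linear)
  then obtain w i where "i \<in> J" "deriv_within V X u w $ i \<noteq> 0"
    using linear_range_two_coordinates_nonzero[OF _ inj card J] by blast
  then show False using der0[of w] by (auto simp: P_def vec_eq_iff split: if_splits)
qed

section \<open>Outward normals of the domains\<close>

text \<open>\<open>outward_unit_normal\<close> admits any local defining function \<rho>, which is
  compared here with the given \<open>h\<close>. If \<open>v \<bullet> G < 0\<close>, the ray from
  \<open>p\<close> along \<open>v\<close> starts inside \<Omega>, where \<rho> is negative, so
  \<open>v \<bullet> D \<le> 0\<close>. An inclusion of half-spaces like this makes \<open>D\<close>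
  a nonnegative multiple of \<open>G\<close>.\<close>

lemma outward_unit_normal_sublevel:
  assumes out: "outward_unit_normal \<Omega> p \<nu>" and \<Omega>: "\<Omega> = {x. h x < 0}"
    and h: "h p = 0" "GDERIV h p :> G" "G \<noteq> 0"
  shows "\<exists>s>0. \<nu> = s *\<^sub>R G"
proof -
  obtain W \<rho> D where W: "open W" "p \<in> W" "\<Omega> \<inter> W = {x\<in>W. \<rho> x < 0}" "\<rho> p = 0"
    and \<rho>: "GDERIV \<rho> p :> D" and D: "D \<noteq> 0" "\<nu> = D /\<^sub>R norm D"
    using out unfolding outward_unit_normal_def by blast
  have line: "DERIV (\<lambda>t. f (p + t *\<^sub>R v)) 0 :> v \<bullet> K" if "GDERIV f p :> K" for f K v
  proof -
    have "((\<lambda>t. p + t *\<^sub>R v) has_derivative (\<lambda>h. h *\<^sub>R v)) (at 0)"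
      by (auto intro!: derivative_eq_intros)
    from has_derivative_compose[OF this, of f "\<lambda>h. h \<bullet> K"] that show ?thesis
      by (simp add: gderiv_def has_field_derivative_def mult_commute_abs)
  qed
  have strict: "v \<bullet> D \<le> 0" if v: "v \<bullet> G < 0" for v
  proof (rule ccontr)
    assume "\<not> v \<bullet> D \<le> 0"
    then obtain r1 where r1: "r1 > 0" "\<And>t. \<lbrakk>0 < t; t < r1\<rbrakk> \<Longrightarrow> \<rho> p < \<rho> (p + t *\<^sub>R v)"
      using DERIV_pos_inc_right[OF line[OF \<rho>, of v]] by auto
    obtain r2 where r2: "r2 > 0" "\<And>t. \<lbrakk>0 < t; t < r2\<rbrakk> \<Longrightarrow> h (p + t *\<^sub>R v) < h p"
      using DERIV_neg_dec_right[OF line[OF h(2), of v] v] by auto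
    have "\<forall>\<^sub>F t in at (0::real). p + t *\<^sub>R v \<in> W"
      using W by (intro topological_tendstoD[where l = p]) (auto intro!: tendsto_eq_intros)
    then obtain r3 where r3: "r3 > 0" "\<And>t. \<lbrakk>t \<noteq> 0; dist t 0 < r3\<rbrakk> \<Longrightarrow> p + t *\<^sub>R v \<in> W"
      by (auto simp: eventually_at)
    obtain t where t: "0 < t" "t < min r1 (min r2 r3)"
      using dense[of 0 "min r1 (min r2 r3)"] r1(1) r2(1) r3(1) by auto
    then have "p + t *\<^sub>R v \<in> \<Omega> \<inter> W" using r2(2)[of t] r3(2)[of t] h(1) \<Omega> by auto
    then have "\<rho> (p + t *\<^sub>R v) < 0" using W(3) by blast
    then show False using r1(2)[of t] t W(4) by simp
  qed
  have weak: "v \<bullet> D \<le> 0" if v: "v \<bullet> G = 0" for v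
  proof (rule ccontr)
    assume a: "\<not> v \<bullet> D \<le> 0"
    define K where "K = 1 + \<bar>G \<bullet> D\<bar>"
    have K: "K > 0" by (simp add: K_def add_pos_nonneg)
    \<comment> \<open>Tilting \<open>v\<close> by \<epsilon> against \<open>G\<close> makes the
      strict case applicable; this \<epsilon> changes \<open>v \<bullet> D\<close> by at most one
      half of it. The summand 1 in \<open>K\<close> keeps the denominator positive if
      \<open>G \<bullet> D = 0\<close>.\<close>
    define \<epsilon> where "\<epsilon> = (v \<bullet> D) / (2 * K)"
    have \<epsilon>: "\<epsilon> > 0" using a K by (simp add: \<epsilon>_def)
    then have "(v - \<epsilon> *\<^sub>R G) \<bullet> G < 0" using v h(3) by (simp add: inner_diff_left)
    then have "v \<bullet> D \<le> \<epsilon> * (G \<bullet> D)" using strict[of "v - \<epsilon> *\<^sub>R G"] by (simp add: inner_diff_left)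
    also have "\<dots> \<le> \<epsilon> * K" using \<epsilon> by (intro mult_left_mono) (auto simp: K_def)
    also have "\<dots> = (v \<bullet> D) / 2" using K by (simp add: \<epsilon>_def)
    finally show False using a by simp
  qed
  define s where "s = (D \<bullet> G) / (G \<bullet> G)"
  \<comment> \<open>The part of \<open>D\<close> orthogonal to \<open>G\<close>: its squared norm is
    \<open>v \<bullet> D\<close>, which \<open>weak\<close> bounds by 0.\<close>
  define v where "v = D - s *\<^sub>R G"
  have v: "v \<bullet> G = 0" using h(3) by (simp add: v_def s_def inner_diff_left)
  have "v \<bullet> v = v \<bullet> D" using v by (simp add: v_def inner_diff_right)
  then have "v \<bullet> v \<le> 0" using weak[OF v] by simp
  then have "v = 0" by (metis inner_gt_zero_iff not_le)
  then have Ds: "D = s *\<^sub>R G" by (simp add: v_def)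
  \<comment> \<open>The direction \<open>- G\<close> determines the sign of
    \<open>s\<close>.\<close>
  have "(- G) \<bullet> D \<le> 0" using h(3) by (intro strict) simp
  then have "0 \<le> s * (G \<bullet> G)" by (simp add: Ds)
  moreover have "G \<bullet> G > 0" using h(3) by simp
  ultimately have "s \<ge> 0" by (simp add: zero_le_mult_iff)
  then have "s > 0" using D(1) Ds by (cases "s = 0") auto
  then show ?thesis using D Ds by (intro exI[of _ "s / norm D"]) (simp add: divide_inverse mult.commute)
qed

section \<open>The two quadric domains\<close>

theorem theorem4:
  fixes n :: nat and c :: real and e :: "nat \<Rightarrow> 'n::finite"
    and F :: "real^'n \<Rightarrow> real" and \<Omega> :: "(real^'n) set"
  assumes "n \<ge> 3" and "CARD('n) = n" and "bij_betw e {1..n} (UNIV :: 'n set)"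
    and "c \<ge> 1"
    and "F = (\<lambda>x. (\<Sum>i=1..n-2. (x $ e i)^2) - (x $ e n)^2 + c)"
    and "\<Omega> = {x. F x < 1} \<or> \<Omega> = {x. F x > 1}"
  shows "\<not> (\<exists>(k::'m::finite) (M::'a topology) (A::('a, 'm) chart set) (\<phi>::'a \<Rightarrow> real^'n).
           immersed_hypersurface k M A \<phi> \<and>
           topspace M \<noteq> {} \<and> compact_space M \<and> connected_space M \<and>
           \<phi> ` topspace M \<subseteq> closure \<Omega> \<and>
           \<phi> ` manifold_boundary k A \<subseteq> frontier \<Omega> \<inter> {p. F p = 1 \<and> \<not> (GDERIV F p :> 0)} \<and>
           minimal A \<phi> \<and>
           has_free_boundary \<Omega> k A \<phi>)"
proof
  assume "\<exists>(k::'m::finite) (M::'a topology) (A::('a, 'm) chart set) (\<phi>::'a \<Rightarrow> real^'n).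
           immersed_hypersurface k M A \<phi> \<and>
           topspace M \<noteq> {} \<and> compact_space M \<and> connected_space M \<and>
           \<phi> ` topspace M \<subseteq> closure \<Omega> \<and>
           \<phi> ` manifold_boundary k A \<subseteq> frontier \<Omega> \<inter> {p. F p = 1 \<and> \<not> (GDERIV F p :> 0)} \<and>
           minimal A \<phi> \<and>
           has_free_boundary \<Omega> k A \<phi>"
  then obtain k :: 'm and M :: "'a topology" and A :: "('a, 'm) chart set" and \<phi> :: "'a \<Rightarrow> real^'n"
    where imm: "immersed_hypersurface k M A \<phi>" and M: "topspace M \<noteq> {}" "compact_space M"
      and bd: "\<phi> ` manifold_boundary k A \<subseteq> {p. F p = 1 \<and> \<not> (GDERIV F p :> 0)}"
      and minimal: "minimal A \<phi>" and free: "has_free_boundary \<Omega> k A \<phi>"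
    by (elim exE conjE) (rule that, auto)
  have inj: "e i = e j \<longleftrightarrow> i = j" if "i \<in> {1..n}" "j \<in> {1..n}" for i j
    using assms(3) that by (meson bij_betw_def inj_on_eq_iff)
  have neq: "e n \<noteq> e (n - 1)" using assms(1) by (simp add: inj)
  define a :: "'n \<Rightarrow> real" where "a i = (if i = e n then -1 else if i = e (n - 1) then 0 else 1)" for i
  have F: "F x = (\<Sum>i\<in>UNIV. a i * (x $ i)^2) + c" for x
  proof -
    obtain m where m: "n = Suc (Suc m)"
      using that[of "n - 2"] assms(1) by simp
    have split: "(\<Sum>i\<in>{1..n}. h i) = (\<Sum>i\<in>{1..n-2}. h i) + h (n - 1) + h n" for h :: "nat \<Rightarrow> real"
      by (simp add: m)
    have "(\<Sum>i\<in>UNIV. a i * (x $ i)^2) = (\<Sum>i\<in>{1..n}. a (e i) * (x $ e i)^2)"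
      using sum.reindex_bij_betw[OF assms(3), of "\<lambda>i. a i * (x $ i)^2"] by simp
    also have "\<dots> = (\<Sum>i\<in>{1..n-2}. a (e i) * (x $ e i)^2) - (x $ e n)^2"
      unfolding split using neq by (simp add: a_def)
    also have "(\<Sum>i\<in>{1..n-2}. a (e i) * (x $ e i)^2) = (\<Sum>i\<in>{1..n-2}. (x $ e i)^2)"
      using assms(1) by (intro sum.cong) (auto simp: a_def inj)
    finally show ?thesis by (simp add: assms(5))
  qed
  define G :: "real^'n \<Rightarrow> real^'n" where "G x = (\<chi> i. 2 * a i * x $ i)" for x
  have dF: "GDERIV F x :> G x" for x
    unfolding gderiv_def F[abs_def]
    by (auto intro!: derivative_eq_intros bounded_linear_imp_has_derivative[OF bounded_linear_vec_nth]
        simp: fun_eq_iff G_def inner_vec_def mult_ac)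
  have main: False if \<Omega>: "\<Omega> = {x. \<sigma> * (F x - 1) < 0}" and J: "2 \<le> card J"
    and sign: "\<And>i. i \<in> J \<Longrightarrow> \<sigma> * a i \<le> 0" and \<sigma>: "\<sigma> \<noteq> 0" for \<sigma> J
  proof (rule minimal_free_boundary_False[OF imm M minimal free J])
    fix x \<nu> assume x: "x \<in> manifold_boundary k A" and \<nu>: "outward_unit_normal \<Omega> (\<phi> x) \<nu>"
    let ?p = "\<phi> x"
    have p: "F ?p = 1" "\<not> (GDERIV F ?p :> 0)" using bd x by auto
    then have "G ?p \<noteq> 0" using dF[of ?p] by metis
    moreover have "GDERIV (\<lambda>x. \<sigma> * (F x - 1)) ?p :> \<sigma> *\<^sub>R G ?p"
      using dF[of ?p] unfolding gderiv_def by (auto intro!: derivative_eq_intros simp: fun_eq_iff)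
    ultimately obtain s where s: "s > 0" "\<nu> = s *\<^sub>R \<sigma> *\<^sub>R G ?p"
      using outward_unit_normal_sublevel[OF \<nu> \<Omega>, of "\<sigma> *\<^sub>R G ?p"] p(1) \<sigma> by auto
    have "?p $ i * \<nu> $ i = (2 * s * (?p $ i)^2) * (\<sigma> * a i)" for i
      by (simp add: s(2) G_def power2_eq_square)
    moreover have "(2 * s * (?p $ i)^2) * (\<sigma> * a i) \<le> 0" if "i \<in> J" for i
      by (rule mult_nonneg_nonpos[OF _ sign[OF that]]) (use s(1) in simp)
    ultimately show "(\<Sum>i\<in>J. ?p $ i * \<nu> $ i) \<le> 0" by (simp add: sum_nonpos)
  qed
  from assms(6) show False
  proof
    assume "\<Omega> = {x. F x < 1}"
    then show False using neq by (intro main[of 1 "{e n, e (n - 1)}"]) (auto simp: a_def)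
  next
    assume "\<Omega> = {x. F x > 1}"
    then show False using assms(1,2)
      by (intro main[of "-1" "- {e n}"]) (auto simp: a_def Compl_eq_Diff_UNIV card_Diff_subset)
  qed
qed

end
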